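(* Let $\mathcal{X},\mathcal{Z}$ be finite sets, let $P_{XZ}$ be a probability distribution on $\mathcal{X}\times\mathcal{Z}$, and for each $n\ge 1$ let $(X^n,Z^n)=((X_1,Z_1),\dots,(X_n,Z_n))$ be i.i.d. with common distribution $P_{XZ}$. Assume that $\sigma^2=\mathrm{Var}\left[\log\frac{1}{P_{X|Z}(X|Z)}\right]$ is positive. Let $\{\Phi_n=(\phi_n,\psi_n)\}_{n\ge1}$ be a sequence of Slepian–Wolf codes, with $\phi_n:\mathcal{X}^n\to\{1,\dots,M_n\}$ and $\psi_n:\{1,\dots,M_n\}\times\mathcal{Z}^n\to\mathcal{X}^n$, such that $$\lim_{n\to\infty}\frac1n\log M_n=H(X|Z)\quad\text{and}\quad \limsup_{n\to\infty}\varepsilon(\Phi_n)<1 .$$ Then there exist a constant $K>0$ and an integer $n_0$ such that $$D(\phi_n)\ge\sqrt{n}\,K\qquad\text{for every } n\ge n_0 .$$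
   Context: All logarithms are natural (base $e$). $H(X|Z)$ is the conditional Shannon entropy for $P_{XZ}$. A Slepian–Wolf code (source coding with full side-information $Z^n$ at the decoder) is a pair of an encoder $\phi_n:\mathcal{X}^n\to\mathcal{M}_n=\{1,\dots,M_n\}$ and a decoder $\psi_n:\mathcal{M}_n\times\mathcal{Z}^n\to\mathcal{X}^n$; its error probability is $\varepsilon(\Phi_n)=P_{X^nZ^n}(\{(x^n,z^n):\psi_n(\phi_n(x^n),z^n)\ne x^n\})$. Put $S_n=\phi_n(X^n)$, and let $P_{U_n}$ be the uniform distribution on $\mathcal{M}_n$. Define $D(\phi_n)=D(P_{S_nZ^n}\,\|\,P_{U_n}\times P_{Z^n})$, where $D(P\|Q)=\sum_a P(a)\log\frac{P(a)}{Q(a)}$ is the Kullback–Leibler divergence. *)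

theory Defs
  imports "HOL-Probability.Probability"
begin

definition cond_prob_given :: "('x \<times> 'z) pmf \<Rightarrow> 'x \<Rightarrow> 'z \<Rightarrow> real" where
  "cond_prob_given P x z = pmf P (x, z) / pmf (map_pmf snd P) z"

definition cond_entropy :: "('x::finite \<times> 'z::finite) pmf \<Rightarrow> real" where
  "cond_entropy P =
     prob_space.conditional_entropy (measure_pmf P) (exp 1) (count_space UNIV) (count_space UNIV) fst snd"

definition cond_varentropy :: "('x::finite \<times> 'z::finite) pmf \<Rightarrow> real" where
  "cond_varentropy P = measure_pmf.variance P (\<lambda>(x, z). ln (1 / cond_prob_given P x z))"

(* Law of (X^n, Z^n); words of length n are lists. *)
definition iid_source :: "('x \<times> 'z) pmf \<Rightarrow> nat \<Rightarrow> ('x list \<times> 'z list) pmf" where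
  "iid_source P n = map_pmf (\<lambda>w. (map fst w, map snd w)) (replicate_pmf n P)"

definition words :: "nat \<Rightarrow> 'a list set" where
  "words n = {w. length w = n}"

definition slepian_wolf_code ::
    "nat \<Rightarrow> nat \<Rightarrow> ('x list \<Rightarrow> nat) \<Rightarrow> (nat \<times> 'z list \<Rightarrow> 'x list) \<Rightarrow> bool" where
  "slepian_wolf_code n M \<phi> \<psi> \<longleftrightarrow>
     \<phi> \<in> words n \<rightarrow> {1..M} \<and> \<psi> \<in> {1..M} \<times> words n \<rightarrow> words n"

definition error_prob ::
    "('x \<times> 'z) pmf \<Rightarrow> nat \<Rightarrow> ('x list \<Rightarrow> nat) \<Rightarrow> (nat \<times> 'z list \<Rightarrow> 'x list) \<Rightarrow> real" where
  "error_prob P n \<phi> \<psi> =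
     measure_pmf.prob (iid_source P n) {(xs, zs). \<psi> (\<phi> xs, zs) \<noteq> xs}"

(* KL_divergence b M N is D(N || M): the reference measure comes first. *)
definition code_divergence ::
    "('x \<times> 'z) pmf \<Rightarrow> nat \<Rightarrow> nat \<Rightarrow> ('x list \<Rightarrow> nat) \<Rightarrow> real" where
  "code_divergence P n M \<phi> =
     KL_divergence (exp 1)
       (measure_pmf (pair_pmf (pmf_of_set {1..M}) (map_pmf snd (iid_source P n))))
       (measure_pmf (map_pmf (\<lambda>(xs, zs). (\<phi> xs, zs)) (iid_source P n)))"


text \<open>Elementary forms of the notions above.\<close>

lemma pmf_iid_source:
  assumes "length xs = n" "length zs = n"
  shows "pmf (iid_source P n) (xs, zs) = (\<Prod>i<n. pmf P (xs ! i, zs ! i))"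
  using assms
proof (induction n arbitrary: xs zs)
  case 0
  then show ?case by (simp add: iid_source_def)
next
  case (Suc n)
  obtain x xs' where xs: "xs = x # xs'" "length xs' = n"
    using Suc.prems(1) by (cases xs) auto
  obtain z zs' where zs: "zs = z # zs'" "length zs' = n"
    using Suc.prems(2) by (cases zs) auto
  have iid_Suc: "iid_source P (Suc n) =
      map_pmf (\<lambda>((a, b), (as, bs)). (a # as, b # bs)) (pair_pmf P (iid_source P n))"
    unfolding iid_source_def pair_pmf_def
    by (simp add: map_pmf_def bind_assoc_pmf bind_return_pmf case_prod_beta)
  have inj: "inj (\<lambda>((a, b), (as, bs)). (a # as, b # bs))"
    by (auto simp: inj_def)
  have "pmf (iid_source P (Suc n)) (xs, zs) = pmf P (x, z) * pmf (iid_source P n) (xs', zs')"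
    using pmf_map_inj'[OF inj, of "pair_pmf P (iid_source P n)" "((x, z), (xs', zs'))"]
    by (simp add: iid_Suc xs zs pmf_pair)
  also have "\<dots> = pmf P (x, z) * (\<Prod>i<n. pmf P (xs' ! i, zs' ! i))"
    using Suc.IH xs zs by simp
  also have "\<dots> = (\<Prod>i<Suc n. pmf P (xs ! i, zs ! i))"
    by (simp add: prod.lessThan_Suc_shift xs zs del: prod.lessThan_Suc)
  finally show ?case .
qed

lemma KL_divergence_pmf:
  fixes p q :: "'a::countable pmf"
  assumes "set_pmf p \<subseteq> set_pmf q" "finite (set_pmf p)"
  shows "KL_divergence (exp 1) (measure_pmf q) (measure_pmf p) =
         (\<Sum>a\<in>set_pmf p. pmf p a * ln (pmf p a / pmf q a))"
proof -
  interpret sigma_finite_measure "count_space (UNIV :: 'a set)"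
    by (rule sigma_finite_measure_count_space)
  have "KL_divergence (exp 1) (measure_pmf q) (measure_pmf p) =
      (\<integral>a. pmf p a * log (exp 1) (pmf p a / pmf q a) \<partial>count_space UNIV)"
    unfolding measure_pmf_eq_density
    using assms(1) by (intro KL_density_density) (auto simp: set_pmf_eq)
  also have "\<dots> = (\<Sum>a | pmf p a * ln (pmf p a / pmf q a) \<noteq> 0. pmf p a * ln (pmf p a / pmf q a))"
    using finite_subset[OF _ assms(2), of "{a. pmf p a * ln (pmf p a / pmf q a) \<noteq> 0}"]
    by (subst lebesgue_integral_count_space_finite_support) (auto simp: log_ln set_pmf_eq)
  also have "\<dots> = (\<Sum>a\<in>set_pmf p. pmf p a * ln (pmf p a / pmf q a))"
    using assms(2) by (intro sum.mono_neutral_left) (auto simp: set_pmf_eq)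
  finally show ?thesis .
qed

lemma code_divergence_eq:
  fixes P :: "('x::finite \<times> 'z::finite) pmf"
  assumes "\<phi> \<in> words n \<rightarrow> {1..M}"
  defines "PSZ \<equiv> map_pmf (\<lambda>(xs, zs). (\<phi> xs, zs)) (iid_source P n)"
    and "PZ \<equiv> map_pmf snd (iid_source P n)"
  shows "code_divergence P n M \<phi> =
    (\<Sum>(s, zs)\<in>{1..M} \<times> words n. pmf PSZ (s, zs) * ln (pmf PSZ (s, zs) / (1 / real M * pmf PZ zs)))"
proof -
  let ?Q = "pair_pmf (pmf_of_set {1..M}) PZ"
  let ?f = "\<lambda>a. pmf PSZ a * ln (pmf PSZ a / pmf ?Q a)"
  have M: "{1..M} \<noteq> {}"
  proof -
    obtain x :: 'x where True by blast
    have "\<phi> (replicate n x) \<in> {1..M}"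
      using assms(1) by (auto simp: words_def Pi_iff)
    then show ?thesis by blast
  qed
  have src: "length xs = n \<and> length zs = n" if "(xs, zs) \<in> set_pmf (iid_source P n)" for xs zs
    using that by (auto simp: iid_source_def set_replicate_pmf)
  have fin: "finite ({1..M} \<times> (words n :: 'z list set))"
    using finite_lists_length_eq[of "UNIV :: 'z set" n] by (simp add: words_def)
  have sub: "set_pmf PSZ \<subseteq> {1..M} \<times> words n"
    unfolding PSZ_def using assms(1) src by (fastforce simp: words_def Pi_iff)
  have ac: "set_pmf PSZ \<subseteq> set_pmf ?Q"
  proof
    fix a assume a: "a \<in> set_pmf PSZ"
    then have "snd a \<in> set_pmf PZ"
      unfolding PSZ_def PZ_def by force
    with a sub M show "a \<in> set_pmf ?Q" by (cases a) auto
  qed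
  have "code_divergence P n M \<phi> = sum ?f (set_pmf PSZ)"
    unfolding code_divergence_def PSZ_def[symmetric] PZ_def[symmetric]
    using ac finite_subset[OF sub fin] by (rule KL_divergence_pmf)
  also have "\<dots> = sum ?f ({1..M} \<times> words n)"
    using sub fin by (intro sum.mono_neutral_left) (auto simp: set_pmf_eq)
  also have "\<dots> = (\<Sum>(s, zs)\<in>{1..M} \<times> words n.
      pmf PSZ (s, zs) * ln (pmf PSZ (s, zs) / (1 / real M * pmf PZ zs)))"
    using M by (intro sum.cong) (auto simp: pmf_pair)
  finally show ?thesis .
qed

lemma cond_entropy_eq:
  "cond_entropy P = (\<Sum>(x, z)\<in>UNIV. pmf P (x, z) * ln (1 / cond_prob_given P x z))"
proof -
  interpret information_space "measure_pmf P" "exp 1"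
    by standard simp
  have sf: "sigma_finite_measure (count_space (UNIV :: 'b set))"
    "sigma_finite_measure (count_space (UNIV :: 'a set))"
    by (simp_all add: sigma_finite_measure_count_space_finite)
  have prod: "count_space (UNIV :: 'a set) \<Otimes>\<^sub>M count_space (UNIV :: 'b set) = count_space UNIV"
    by (simp add: pair_measure_count_space)
  have Y: "distributed (measure_pmf P) (count_space UNIV) snd (pmf (map_pmf snd P))"
    unfolding distributed_def
    by (auto simp: map_pmf_rep_eq[symmetric] measure_pmf_eq_density[symmetric])
  have XY: "distributed (measure_pmf P) (count_space UNIV \<Otimes>\<^sub>M count_space UNIV)
      (\<lambda>w. (fst w, snd w)) (pmf P)"
    unfolding distributed_def prod
    by (auto simp: map_pmf_rep_eq[symmetric] measure_pmf_eq_density[symmetric])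
  have "cond_entropy P = - (\<integral>(x, z). pmf P (x, z) *
      log (exp 1) (pmf P (x, z) / pmf (map_pmf snd P) z) \<partial>(count_space UNIV \<Otimes>\<^sub>M count_space UNIV))"
    unfolding cond_entropy_def
    by (rule conditional_entropy_generic_eq[OF sf(2,1) Y _ XY]) auto
  also have "\<dots> = - (\<Sum>(x, z)\<in>UNIV. pmf P (x, z) * ln (cond_prob_given P x z))"
    by (simp add: prod lebesgue_integral_count_space_finite cond_prob_given_def log_ln)
  also have "\<dots> = (\<Sum>(x, z)\<in>UNIV. pmf P (x, z) * ln (1 / cond_prob_given P x z))"
    by (auto simp: sum_negf[symmetric] ln_div cond_prob_given_def ln_inverse
        inverse_eq_divide[symmetric] algebra_simps intro!: sum.cong)
  finally show ?thesis .
qed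

end

(*
  D(phi_n) is the mean of ln (M_n P(S_n | Z^n)), and P(S_n | Z^n) >= P(X^n | Z^n).
  So D(phi_n) >= t Pr[ln (1 / P(X^n | Z^n)) <= ln M_n - t] - 1 for every t >= 0; take t = sqrt n.
  Given z^n, at most M_n words are decoded correctly, so correct decoding together with
  ln (1 / P(X^n | Z^n)) > ln M_n + sqrt n has probability at most exp (- sqrt n).  As the error
  probability stays away from 1, the central limit theorem for ln (1 / P(X^n | Z^n)) forces
  ln M_n >= n H(X|Z) - O(sqrt n).  By the central limit theorem again, the probability in the
  lower bound for D(phi_n) is then bounded away from 0.
*)
theory Submission
  imports Defs "HOL-Real_Asymp.Real_Asymp"
begin

section \<open>Laws of i.i.d. words\<close>

lemma pmf_replicate_pmf:
  "length w = n \<Longrightarrow> pmf (replicate_pmf n p) w = (\<Prod>a\<leftarrow>w. pmf p a)"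
proof (induction n arbitrary: w)
  case 0
  then show ?case by simp
next
  case (Suc n)
  obtain a v where w: "w = a # v" "length v = n"
    using Suc.prems by (cases w) auto
  have "replicate_pmf (Suc n) p = map_pmf (\<lambda>(x, xs). x # xs) (pair_pmf p (replicate_pmf n p))"
    by (simp add: pair_pmf_def map_pmf_def bind_assoc_pmf bind_return_pmf)
  moreover have "inj (\<lambda>(x, xs). x # xs :: 'a list)"
    by (auto simp: inj_def)
  ultimately show ?case
    using pmf_map_inj'[of "\<lambda>(x, xs). x # xs" "pair_pmf p (replicate_pmf n p)" "(a, v)"] Suc.IH w
    by (simp add: pmf_pair)
qed

lemma map_replicate_pmf:
  "map_pmf (map f) (replicate_pmf n p) = replicate_pmf n (map_pmf f p)"
proof (induction n)
  case (Suc n)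
  show ?case
    by (simp add: map_bind_pmf bind_map_pmf flip: Suc.IH)
qed simp

section \<open>The standard normal distribution function\<close>

text \<open>The normal density is strictly positive, so both measures have the same null sets.
  Positivity and continuity of the distribution function both come from this.\<close>

lemma std_normal_null_set_iff:
  "A \<in> null_sets std_normal_distribution \<longleftrightarrow> A \<in> null_sets lborel"
proof -
  have "\<not> std_normal_density x \<le> 0" for x
    using normal_density_pos[of 1 0 x] by simp
  then show ?thesis
    by (auto simp: null_sets_density_iff AE_iff_null_sets ennreal_eq_0_iff dest: AE_not_in)
qed

text \<open>A half-line contains an interval of length 1 and so is not null. This keeps the limiting
  probability in the divergence bound away from 0.\<close>

lemma std_normal_cdf_pos: "0 < cdf std_normal_distribution x"
proof -
  interpret real_distribution std_normal_distribution
    by (rule real_dist_normal_dist)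
  have "{..x} \<notin> null_sets lborel"
  proof
    assume "{..x} \<in> null_sets lborel"
    then have "{x - 1..x} \<in> null_sets lborel"
      by (rule null_sets_subset) auto
    then show False
      by (auto simp: null_sets_def)
  qed
  then have "{..x} \<notin> null_sets std_normal_distribution"
    by (simp add: std_normal_null_set_iff)
  then show ?thesis
    by (simp add: cdf_def null_sets_def emeasure_eq_measure zero_less_measure_iff)
qed

text \<open>Single points are null. Weak convergence gives convergence of distribution functions at
  continuity points, so every \<open>x\<close> becomes admissible in the central limit
  theorem.\<close>

lemma std_normal_isCont_cdf: "isCont (cdf std_normal_distribution) x"
proof -
  interpret real_distribution std_normal_distribution
    by (rule real_dist_normal_dist)
  have "{x} \<in> null_sets std_normal_distribution"
    unfolding std_normal_null_set_iff by (simp add: null_sets_def)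
  then show ?thesis
    unfolding isCont_cdf by (rule measure_eq_0_null_sets)
qed

section \<open>The central limit theorem for i.i.d. words\<close>

text \<open>Bridge from the infinite product space, which carries the whole sequence of coordinates,
  to words of length \<open>n\<close>. Fixing the first \<open>n\<close> coordinates is a cylinder
  event whose mass is the product of the letter masses, and the event is a finite disjoint union of
  such cylinders.\<close>

lemma prob_PiM_map_upt:
  fixes p :: "'a::finite pmf" and n :: nat
  defines "\<Omega> \<equiv> \<Pi>\<^sub>M i\<in>(UNIV :: nat set). measure_pmf p"
  shows "measure \<Omega> {\<omega> \<in> space \<Omega>. map \<omega> [0..<n] \<in> A} = measure_pmf.prob (replicate_pmf n p) A"
proof -
  interpret product_prob_space "\<lambda>_. measure_pmf p" "UNIV :: nat set" ..
  define W where "W = {w :: 'a list. length w = n}"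
  have finW: "finite W"
    using finite_lists_length_eq[of "UNIV :: 'a set" n] by (simp add: W_def)
  have cyl: "{\<omega> \<in> space \<Omega>. map \<omega> [0..<n] = w} = {\<omega> \<in> space \<Omega>. \<forall>i\<in>{..<n}. \<omega> i \<in> {w ! i}}"
    if "w \<in> W" for w
    using that by (auto simp: W_def list_eq_iff_nth_eq)
  have meas: "{\<omega> \<in> space \<Omega>. map \<omega> [0..<n] = w} \<in> sets \<Omega>" if "w \<in> W" for w
    by (subst cyl[OF that]) (simp add: \<Omega>_def)
  have single: "measure \<Omega> {\<omega> \<in> space \<Omega>. map \<omega> [0..<n] = w} = pmf (replicate_pmf n p) w"
    if w: "w \<in> W" for w
  proof -
    have "emeasure \<Omega> {\<omega> \<in> space \<Omega>. map \<omega> [0..<n] = w} = (\<Prod>i<n. emeasure (measure_pmf p) {w ! i})"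
      by (subst cyl[OF w], unfold \<Omega>_def, rule emeasure_PiM_Collect) auto
    also have "\<dots> = ennreal (\<Prod>i<n. pmf p (w ! i))"
      by (simp add: emeasure_pmf_single prod_ennreal)
    also have "(\<Prod>i<n. pmf p (w ! i)) = pmf (replicate_pmf n p) w"
      using w by (simp add: W_def pmf_replicate_pmf prod.list_conv_set_nth atLeast0LessThan)
    finally show ?thesis
      by (simp add: measure_def)
  qed
  have "{\<omega> \<in> space \<Omega>. map \<omega> [0..<n] \<in> A} = (\<Union>w\<in>A \<inter> W. {\<omega> \<in> space \<Omega>. map \<omega> [0..<n] = w})"
    by (auto simp: W_def)
  also have "measure \<Omega> \<dots> = (\<Sum>w\<in>A \<inter> W. measure \<Omega> {\<omega> \<in> space \<Omega>. map \<omega> [0..<n] = w})"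
    using finW meas
    by (intro measure_finite_Union)
      (auto simp: disjoint_family_on_def \<Omega>_def P.emeasure_eq_measure)
  also have "\<dots> = measure_pmf.prob (replicate_pmf n p) (A \<inter> W)"
    using finW by (simp add: single measure_measure_pmf_finite)
  also have "\<dots> = measure_pmf.prob (replicate_pmf n p) A"
    by (intro measure_pmf.finite_measure_eq_AE) (auto simp: AE_measure_pmf_iff set_replicate_pmf W_def)
  finally show ?thesis .
qed

text \<open>\<open>central_limit_theorem\<close> needs a sequence of independent variables on one
  space; the coordinates under the product measure supply it. The result returns to words by
  \<open>prob_PiM_map_upt\<close>.\<close>

lemma replicate_pmf_central_limit:
  fixes p :: "'a::finite pmf" and Y :: "'a \<Rightarrow> real" and m s x :: real
  defines "m \<equiv> measure_pmf.expectation p Y" and "s \<equiv> sqrt (measure_pmf.variance p Y)"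
  assumes "s > 0"
  shows "(\<lambda>n. measure_pmf.prob (replicate_pmf n p) {w. (\<Sum>a\<leftarrow>w. Y a) \<le> n * m + x * s * sqrt n})
    \<longlonglongrightarrow> cdf std_normal_distribution x"
proof -
  define \<Omega> where "\<Omega> = (\<Pi>\<^sub>M i\<in>(UNIV :: nat set). measure_pmf p)"
  interpret product_prob_space "\<lambda>_. measure_pmf p" "UNIV :: nat set" ..
  interpret \<Omega>: prob_space \<Omega>
    unfolding \<Omega>_def by (rule P.prob_space_axioms)
  have Y[measurable]: "Y \<in> borel_measurable (measure_pmf p)"
    by simp
  have coord[measurable]: "(\<lambda>\<omega>. \<omega> i) \<in> measurable \<Omega> (measure_pmf p)" for i
    unfolding \<Omega>_def by measurable
  have distr_coord: "distr \<Omega> (measure_pmf p) (\<lambda>\<omega>. \<omega> i) = measure_pmf p" for i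
    unfolding \<Omega>_def by (rule PiM_component) simp
  have expect: "\<Omega>.expectation (\<lambda>\<omega>. f (\<omega> i)) = measure_pmf.expectation p f"
    and integ: "integrable \<Omega> (\<lambda>\<omega>. f (\<omega> i))" for f :: "'a \<Rightarrow> real" and i
  proof -
    have f[measurable]: "f \<in> borel_measurable (measure_pmf p)" by simp
    show "\<Omega>.expectation (\<lambda>\<omega>. f (\<omega> i)) = measure_pmf.expectation p f"
      by (subst distr_coord[of i, symmetric], subst integral_distr[OF coord f]) simp
    show "integrable \<Omega> (\<lambda>\<omega>. f (\<omega> i))"
      by (rule integrable_distr[OF coord[of i]])
        (simp add: distr_coord integrable_measure_pmf_finite)
  qed
  \<comment> \<open>Independence means that the joint law is the product of the marginals; the joint
    law of all coordinates is \<open>\<Omega>\<close> itself.\<close>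
  have indep: "\<Omega>.indep_vars (\<lambda>_. measure_pmf p) (\<lambda>i \<omega>. \<omega> i) UNIV"
  proof (subst \<Omega>.indep_vars_iff_distr_eq_PiM')
    show "\<Omega>.random_variable (measure_pmf p) (\<lambda>\<omega>. \<omega> i)" for i
      by (rule coord)
  qed (simp_all add: distr_coord restrict_UNIV flip: \<Omega>_def)
  have "weak_conv_m (\<lambda>n. distr \<Omega> borel (\<lambda>\<omega>. (\<Sum>i<n. Y (\<omega> i) - m) / sqrt (n * s\<^sup>2)))
      std_normal_distribution"
  proof (rule \<Omega>.central_limit_theorem)
    show "\<Omega>.indep_vars (\<lambda>_. borel) (\<lambda>i \<omega>. Y (\<omega> i)) UNIV"
      using indep by (rule \<Omega>.indep_vars_compose2) simp
    show "distr \<Omega> borel (\<lambda>\<omega>. Y (\<omega> i)) = distr (measure_pmf p) borel Y" for i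
      using distr_distr[OF Y coord[of i]] by (simp only: distr_coord comp_def)
    show "integrable \<Omega> (\<lambda>\<omega>. (Y (\<omega> i))\<^sup>2)" for i
      by (rule integ[of "\<lambda>a. (Y a)\<^sup>2"])
    show "s > 0" by fact
    show "\<Omega>.expectation (\<lambda>\<omega>. Y (\<omega> i)) = m" for i
      by (simp add: expect m_def)
    have "s\<^sup>2 = measure_pmf.variance p Y"
      unfolding s_def by (rule real_sqrt_pow2) (simp add: integral_nonneg)
    then show "\<Omega>.variance (\<lambda>\<omega>. Y (\<omega> i)) = s\<^sup>2" for i
      using expect[of "\<lambda>a. (Y a - m)\<^sup>2" i] by (simp add: expect flip: m_def)
  qed
  then have lim: "(\<lambda>n. cdf (distr \<Omega> borel (\<lambda>\<omega>. (\<Sum>i<n. Y (\<omega> i) - m) / sqrt (n * s\<^sup>2))) x)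
      \<longlonglongrightarrow> cdf std_normal_distribution x"
    by (auto simp: weak_conv_m_def weak_conv_def std_normal_isCont_cdf)
  \<comment> \<open>At \<open>n = 0\<close> the quotient is \<open>0 / 0 = 0\<close>, and the two
    sides differ for \<open>x < 0\<close>; hence the restriction, which a limit does not
    notice.\<close>
  have "cdf (distr \<Omega> borel (\<lambda>\<omega>. (\<Sum>i<n. Y (\<omega> i) - m) / sqrt (n * s\<^sup>2))) x =
      measure_pmf.prob (replicate_pmf n p) {w. (\<Sum>a\<leftarrow>w. Y a) \<le> n * m + x * s * sqrt n}"
    if "n > 0" for n :: nat
  proof -
    have "(\<Sum>i<n. Y (\<omega> i) - m) / sqrt (n * s\<^sup>2) \<le> x \<longleftrightarrow>
        (\<Sum>a\<leftarrow>map \<omega> [0..<n]. Y a) \<le> n * m + x * s * sqrt n" for \<omega>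
      using \<open>n > 0\<close> \<open>s > 0\<close>
      by (auto simp: real_sqrt_mult pos_divide_le_eq sum_subtractf interv_sum_list_conv_sum_set_nat
          comp_def atLeast0LessThan algebra_simps)
    then have eq: "(\<lambda>\<omega>. (\<Sum>i<n. Y (\<omega> i) - m) / sqrt (n * s\<^sup>2)) -` {..x} \<inter> space \<Omega> =
        {\<omega> \<in> space \<Omega>. map \<omega> [0..<n] \<in> {w. (\<Sum>a\<leftarrow>w. Y a) \<le> n * m + x * s * sqrt n}}"
      by auto
    have "cdf (distr \<Omega> borel (\<lambda>\<omega>. (\<Sum>i<n. Y (\<omega> i) - m) / sqrt (n * s\<^sup>2))) x =
        measure \<Omega> ((\<lambda>\<omega>. (\<Sum>i<n. Y (\<omega> i) - m) / sqrt (n * s\<^sup>2)) -` {..x} \<inter> space \<Omega>)"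
      unfolding cdf_def by (rule measure_distr) simp_all
    then show ?thesis
      unfolding eq unfolding \<Omega>_def prob_PiM_map_upt .
  qed
  then show ?thesis
    by (intro Lim_transform_eventually[OF lim] eventually_mono[OF eventually_gt_at_top[of 0]])
qed

section \<open>Conditional information of letters and words\<close>

text \<open>The conditional self-information of a letter pair. Its mean is
  \<open>cond_entropy P\<close> and its variance is \<open>cond_varentropy P\<close>.\<close>

definition cond_info :: "('x \<times> 'z) pmf \<Rightarrow> 'x \<times> 'z \<Rightarrow> real" where
  "cond_info P = (\<lambda>(x, z). ln (1 / cond_prob_given P x z))"

text \<open>The support matters: where \<open>P\<close> vanishes, the defaults
  \<open>1 / 0 = 0\<close> and \<open>ln 0 = 0\<close> give \<open>cond_info P a = 0\<close>, and
  the identity fails if the marginal is positive there.\<close>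

lemma pmf_eq_exp_cond_info:
  assumes "a \<in> set_pmf P"
  shows "pmf P a = pmf (map_pmf snd P) (snd a) * exp (- cond_info P a)"
proof -
  obtain x z where a: "a = (x, z)" by (cases a)
  have pos: "0 < pmf P (x, z)" "0 < pmf (map_pmf snd P) z"
    using assms unfolding a by (force intro!: pmf_positive)+
  then have "cond_info P a = - ln (pmf P (x, z) / pmf (map_pmf snd P) z)"
    by (simp add: cond_info_def cond_prob_given_def a ln_div)
  with pos show ?thesis
    by (simp add: a)
qed

text \<open>The law of a word and its marginal on the side information both factor over positions,
  so the identity for letters multiplies up. Both bounds on codes use it to turn thresholds for the
  sum into bounds on probabilities.\<close>

lemma pmf_replicate_eq_exp_cond_info:
  fixes P :: "('x \<times> 'z) pmf"
  assumes "w \<in> set_pmf (replicate_pmf n P)"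
  shows "pmf (replicate_pmf n P) w =
    pmf (map_pmf snd (iid_source P n)) (map snd w) * exp (- (\<Sum>a\<leftarrow>w. cond_info P a))"
proof -
  have "set w \<subseteq> set_pmf P" "length w = n"
    using assms by (auto simp: set_replicate_pmf)
  then have "(\<Prod>a\<leftarrow>w. pmf P a) =
      (\<Prod>a\<leftarrow>w. pmf (map_pmf snd P) (snd a)) * exp (- (\<Sum>a\<leftarrow>w. cond_info P a))"
    by (induction w arbitrary: n)
      (auto simp: pmf_eq_exp_cond_info[of _ P] exp_diff exp_minus field_simps)
  moreover have "map_pmf snd (iid_source P n) = replicate_pmf n (map_pmf snd P)"
    by (simp add: iid_source_def pmf.map_comp comp_def flip: map_replicate_pmf)
  ultimately show ?thesis
    using \<open>length w = n\<close> by (simp add: pmf_replicate_pmf comp_def)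
qed

section \<open>Bounds for a single code\<close>

lemma finite_words: "finite (words n :: 'a::finite list set)"
  using finite_lists_length_eq[of "UNIV :: 'a set" n] by (simp add: words_def)

text \<open>Each \<open>a\<close> contributes at most the total mass of \<open>Z\<close>. With
  \<open>A = {1..M}\<close> this stands for the count of at most \<open>M\<close> decodable words
  per side information, and it also bounds the mass of the reference distribution.\<close>

lemma sum_pmf_snd_le_card:
  assumes "finite B"
  shows "(\<Sum>c\<in>A \<times> B. pmf Z (snd c)) \<le> real (card A)"
proof -
  have "(\<Sum>c\<in>A \<times> B. pmf Z (snd c)) = (\<Sum>a\<in>A. measure_pmf.prob Z B)"
    using assms by (simp add: sum.cartesian_product' measure_measure_pmf_finite)
  also have "\<dots> \<le> real (card A) * 1"
    by (intro sum_bounded_above) simp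
  finally show ?thesis by simp
qed

text \<open>Up to a null set, a correctly decoded word lies in \<open>low\<close> or in
  \<open>C\<close>. The threshold \<open>L\<close> is left free; the later choice
  \<open>ln M + sqrt n\<close> makes the last term \<open>exp (- sqrt n)\<close>.\<close>

lemma prob_correct_le:
  fixes P :: "('x::finite \<times> 'z::finite) pmf"
  assumes "slepian_wolf_code n M \<phi> \<psi>"
  shows "1 - error_prob P n \<phi> \<psi> \<le>
    measure_pmf.prob (replicate_pmf n P) {w. (\<Sum>a\<leftarrow>w. cond_info P a) \<le> L} + M * exp (- L)"
proof -
  let ?W = "replicate_pmf n P" and ?PZ = "map_pmf snd (iid_source P n)"
  let ?f = "\<lambda>w. (\<phi> (map fst w), map snd w)"
  define good where "good = {w. \<psi> (?f w) = map fst w}"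
  define low where "low = {w. (\<Sum>a\<leftarrow>w. cond_info P a) \<le> L}"
  define C where "C = (good - low) \<inter> set_pmf ?W"
  have supp: "set_pmf ?W \<subseteq> words n"
    by (auto simp: set_replicate_pmf words_def)
  then have finC: "finite C"
    unfolding C_def by (meson finite_words finite_subset inf_le2)
  \<comment> \<open>A correctly decoded \<open>w\<close> is recovered from its image: the decoder
    returns the first components, and zipping them with the side information gives
    \<open>w\<close>.\<close>
  have inj: "inj_on ?f C"
    by (rule inj_onI) (metis (mono_tags, lifting) C_def DiffD1 IntD1 good_def mem_Collect_eq
        prod.inject zip_map_fst_snd)
  have img: "?f ` C \<subseteq> {1..M} \<times> words n"
    using assms supp by (fastforce simp: C_def slepian_wolf_code_def words_def Pi_iff)
  have "1 - error_prob P n \<phi> \<psi> = measure_pmf.prob ?W good"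
  proof -
    have "error_prob P n \<phi> \<psi> = measure_pmf.prob ?W (UNIV - good)"
      by (simp add: error_prob_def iid_source_def good_def vimage_def set_diff_eq)
    then show ?thesis
      using measure_pmf.prob_compl[of good ?W] by simp
  qed
  also have "\<dots> \<le> measure_pmf.prob ?W (low \<union> (good - low))"
    by (rule measure_pmf.finite_measure_mono) auto
  also have "\<dots> \<le> measure_pmf.prob ?W low + measure_pmf.prob ?W (good - low)"
    by (rule measure_Un_le) auto
  also have "measure_pmf.prob ?W (good - low) = measure_pmf.prob ?W C"
    by (simp add: C_def measure_Int_set_pmf)
  also have "\<dots> = (\<Sum>w\<in>C. pmf ?W w)"
    using finC by (rule measure_measure_pmf_finite)
  also have "\<dots> \<le> (\<Sum>w\<in>C. pmf ?PZ (snd (?f w)) * exp (- L))"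
  proof (rule sum_mono)
    fix w assume "w \<in> C"
    then show "pmf ?W w \<le> pmf ?PZ (snd (?f w)) * exp (- L)"
      by (auto simp: C_def low_def pmf_replicate_eq_exp_cond_info intro!: mult_left_mono)
  qed
  also have "\<dots> = (\<Sum>c\<in>?f ` C. pmf ?PZ (snd c) * exp (- L))"
    using inj by (simp add: sum.reindex)
  also have "\<dots> \<le> (\<Sum>c\<in>{1..M} \<times> words n. pmf ?PZ (snd c) * exp (- L))"
    using img by (intro sum_mono2) (auto simp: finite_words)
  also have "\<dots> = (\<Sum>c\<in>{1..M} \<times> words n. pmf ?PZ (snd c)) * exp (- L)"
    by (rule sum_distrib_right[symmetric])
  also have "\<dots> \<le> M * exp (- L)"
    using sum_pmf_snd_le_card[OF finite_words, of ?PZ "{1..M}" n] by (intro mult_right_mono) auto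
  finally show ?thesis
    unfolding low_def by simp
qed

text \<open>Let \<open>p\<close> be the law of index and side information and \<open>q\<close> the
  reference. Termwise, \<open>p * ln (p / q)\<close> is at least \<open>t * p - q\<close> on the set
  \<open>B\<close> where \<open>p \<ge> exp t * q\<close>, and at least \<open>- q\<close>
  elsewhere. Summing \<open>q\<close> costs at most 1.\<close>

lemma code_divergence_ge:
  fixes P :: "('x::finite \<times> 'z::finite) pmf"
  assumes "\<phi> \<in> words n \<rightarrow> {1..M}" "M > 0" "t \<ge> 0"
  shows "t * measure_pmf.prob (replicate_pmf n P) {w. (\<Sum>a\<leftarrow>w. cond_info P a) \<le> ln M - t} - 1
    \<le> code_divergence P n M \<phi>"
proof -
  let ?W = "replicate_pmf n P" and ?PZ = "map_pmf snd (iid_source P n)"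
  let ?f = "\<lambda>w. (\<phi> (map fst w), map snd w)"
  define PSZ where "PSZ = map_pmf ?f ?W"
  have PSZ: "PSZ = map_pmf (\<lambda>(xs, zs). (\<phi> xs, zs)) (iid_source P n)"
    by (simp add: PSZ_def iid_source_def pmf.map_comp comp_def)
  \<comment> \<open>On the set \<open>A\<close> below, this is the mass of the uniform index paired
    with independent side information.\<close>
  define q where "q = (\<lambda>c :: nat \<times> 'z list. pmf ?PZ (snd c) / M)"
  define B where "B = {c. exp t * q c \<le> pmf PSZ c}"
  define A where "A = {1..M} \<times> (words n :: 'z list set)"
  have finA: "finite A"
    by (simp add: A_def finite_words)
  have supp: "set_pmf ?W \<subseteq> words n"
    by (auto simp: set_replicate_pmf words_def)
  have suppA: "set_pmf PSZ \<subseteq> A"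
    using assms(1) supp by (fastforce simp: A_def PSZ_def words_def Pi_iff)
  have q_pos: "0 < q c" if "0 < pmf PSZ c" for c
  proof -
    from that have "snd c \<in> snd ` set_pmf PSZ"
      by (simp add: pmf_positive_iff)
    also have "\<dots> = set_pmf ?PZ"
      by (force simp: PSZ)
    finally show ?thesis
      using \<open>M > 0\<close> by (simp add: q_def pmf_positive)
  qed
  have q_nonneg: "0 \<le> q c" for c
    by (simp add: q_def)
  have "measure_pmf.prob ?W {w. (\<Sum>a\<leftarrow>w. cond_info P a) \<le> ln M - t} \<le> measure_pmf.prob ?W (?f -` B)"
  proof (rule measure_pmf.finite_measure_mono_AE)
    show "AE w in measure_pmf ?W. w \<in> {w. (\<Sum>a\<leftarrow>w. cond_info P a) \<le> ln M - t} \<longrightarrow> w \<in> ?f -` B"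
    proof (subst AE_measure_pmf_iff, intro ballI impI)
      fix w assume w: "w \<in> set_pmf ?W" "w \<in> {w. (\<Sum>a\<leftarrow>w. cond_info P a) \<le> ln M - t}"
      have "exp t * q (?f w) = pmf ?PZ (map snd w) * exp (t - ln M)"
        using \<open>M > 0\<close> by (simp add: q_def exp_diff)
      also have "\<dots> \<le> pmf ?PZ (map snd w) * exp (- (\<Sum>a\<leftarrow>w. cond_info P a))"
        using w by (intro mult_left_mono) auto
      also have "\<dots> = pmf ?W w"
        using w by (simp add: pmf_replicate_eq_exp_cond_info)
      also have "\<dots> = measure_pmf.prob ?W {w}"
        by (simp add: pmf.rep_eq)
      \<comment> \<open>Words that share index and side information are merged, so the image point
        has at least the mass of \<open>w\<close>. This is where P(S|Z) >= P(X|Z) enters.\<close>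
      also have "\<dots> \<le> measure_pmf.prob ?W (?f -` {?f w})"
        by (rule measure_pmf.finite_measure_mono) auto
      also have "\<dots> = pmf PSZ (?f w)"
        by (simp add: PSZ_def pmf_map)
      finally show "w \<in> ?f -` B"
        by (simp add: B_def)
    qed
  qed simp
  also have "measure_pmf.prob ?W (?f -` B) = measure_pmf.prob PSZ B"
    by (simp add: PSZ_def)
  also have "\<dots> = measure_pmf.prob PSZ (A \<inter> B)"
    using suppA by (intro measure_pmf.finite_measure_eq_AE) (auto simp: AE_measure_pmf_iff)
  also have "\<dots> = (\<Sum>c\<in>A \<inter> B. pmf PSZ c)"
    using finA by (simp add: measure_measure_pmf_finite)
  also have "\<dots> = (\<Sum>c\<in>A. pmf PSZ c * indicator B c)"
    unfolding sum.inter_restrict[OF finA] by (rule sum.cong) auto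
  finally have prob: "measure_pmf.prob ?W {w. (\<Sum>a\<leftarrow>w. cond_info P a) \<le> ln M - t} \<le>
    (\<Sum>c\<in>A. pmf PSZ c * indicator B c)" .
  have q_le: "(\<Sum>c\<in>A. q c) \<le> 1"
    using sum_pmf_snd_le_card[OF finite_words, of ?PZ "{1..M}" n] \<open>M > 0\<close>
    by (simp add: A_def q_def flip: sum_divide_distrib)
  have "t * measure_pmf.prob ?W {w. (\<Sum>a\<leftarrow>w. cond_info P a) \<le> ln M - t} - 1 \<le>
      t * (\<Sum>c\<in>A. pmf PSZ c * indicator B c) - (\<Sum>c\<in>A. q c)"
    using mult_left_mono[OF prob \<open>t \<ge> 0\<close>] q_le by linarith
  also have "\<dots> = (\<Sum>c\<in>A. t * (pmf PSZ c * indicator B c) - q c)"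
    by (simp add: sum_distrib_left sum_subtractf)
  also have "\<dots> \<le> (\<Sum>c\<in>A. pmf PSZ c * ln (pmf PSZ c / q c))"
  proof (rule sum_mono)
    fix c
    let ?p = "pmf PSZ c"
    show "t * (?p * indicator B c) - q c \<le> ?p * ln (?p / q c)"
    proof (cases "?p = 0")
      case True
      then show ?thesis using q_nonneg by simp
    next
      case False
      then have p: "0 < ?p" by (simp add: pmf_positive_iff set_pmf_iff)
      note q = q_pos[OF p]
      show ?thesis
      proof (cases "c \<in> B")
        case True
        then have "exp t \<le> ?p / q c"
          using q by (simp add: B_def pos_le_divide_eq)
        then have "t \<le> ln (?p / q c)"
          using p q by (simp add: ln_ge_iff)
        then have "?p * t \<le> ?p * ln (?p / q c)"
          by (intro mult_left_mono) auto
        then show ?thesis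
          using True q by (simp add: mult.commute)
      next
        case False
        \<comment> \<open>Off \<open>B\<close> the logarithm may be negative; this inequality still
          gives \<open>p * ln (p / q) \<ge> p - q \<ge> - q\<close>.\<close>
        have "ln (q c / ?p) \<le> q c / ?p - 1"
          using p q by (intro ln_le_minus_one) auto
        then have "?p * (1 - q c / ?p) \<le> ?p * ln (?p / q c)"
          using p q by (intro mult_left_mono) (auto simp: ln_div)
        then show ?thesis
          using False p by (simp add: right_diff_distrib)
      qed
    qed
  qed
  also have "\<dots> = code_divergence P n M \<phi>"
    using code_divergence_eq[OF assms(1), of P]
    by (simp add: A_def q_def case_prod_beta flip: PSZ)
  finally show ?thesis .
qed

section \<open>Growth of the divergence\<close>

lemma expectation_cond_info:
  fixes P :: "('x::finite \<times> 'z::finite) pmf"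
  shows "measure_pmf.expectation P (cond_info P) = cond_entropy P"
  by (subst integral_measure_pmf[of UNIV]) (auto simp: cond_entropy_eq cond_info_def case_prod_beta)

theorem mainTheorem2:
  fixes P :: "('x::finite \<times> 'z::finite) pmf"
    and M :: "nat \<Rightarrow> nat"
    and \<phi> :: "nat \<Rightarrow> 'x list \<Rightarrow> nat"
    and \<psi> :: "nat \<Rightarrow> nat \<times> 'z list \<Rightarrow> 'x list"
  assumes var_pos: "cond_varentropy P > 0"
    and code: "\<And>n. n \<ge> 1 \<Longrightarrow> slepian_wolf_code n (M n) (\<phi> n) (\<psi> n)"
    and rate: "(\<lambda>n. ln (real (M n)) / real n) \<longlonglongrightarrow> cond_entropy P"
    and error: "limsup (\<lambda>n. ereal (error_prob P n (\<phi> n) (\<psi> n))) < 1"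
  shows "\<exists>K>0. \<exists>n0\<ge>1. \<forall>n\<ge>n0. code_divergence P n (M n) (\<phi> n) \<ge> sqrt (real n) * K"
proof -
  define s where "s = sqrt (cond_varentropy P)"
  define h where "h = cond_entropy P"
  define F where "F n y = measure_pmf.prob (replicate_pmf n P) {w. (\<Sum>a\<leftarrow>w. cond_info P a) \<le> y}"
    for n y
  let ?\<Phi> = "cdf std_normal_distribution"
  interpret N: real_distribution std_normal_distribution
    by (rule real_dist_normal_dist)
  have F_mono: "F n y \<le> F n y'" if "y \<le> y'" for n y y'
    unfolding F_def using that by (intro measure_pmf.finite_measure_mono) auto
  have s: "s > 0"
    using var_pos by (simp add: s_def)
  have s_var: "s = sqrt (measure_pmf.variance P (cond_info P))"
    by (simp add: s_def cond_varentropy_def cond_info_def)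
  have clt: "(\<lambda>n. F n (n * h + x * s * sqrt n)) \<longlonglongrightarrow> ?\<Phi> x" for x
    using replicate_pmf_central_limit[of P "cond_info P" x, folded s_var] s
    by (simp add: F_def h_def expectation_cond_info)

  obtain r where "limsup (\<lambda>n. ereal (error_prob P n (\<phi> n) (\<psi> n))) < ereal r" "r < 1"
    using ereal_dense2[OF error] by auto
  then have ev_error: "\<forall>\<^sub>F n in sequentially. error_prob P n (\<phi> n) (\<psi> n) < r"
    by (auto dest: Limsup_lessD)
  \<comment> \<open>Correct decoding eventually has probability above
    \<open>1 - r = 3 * \<delta>\<close>, while the two terms of \<open>prob_correct_le\<close> will
    be pushed below \<open>\<delta>\<close> each.\<close>
  define \<delta> where "\<delta> = (1 - r) / 3"
  have "\<delta> > 0"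
    using \<open>r < 1\<close> by (simp add: \<delta>_def)
  then obtain x0 where x0: "?\<Phi> x0 < \<delta>"
    using order_tendstoD(2)[OF N.cdf_lim_at_bot] by (auto simp: eventually_at_bot_linorder)
  \<comment> \<open>Moving from \<open>x0\<close> to \<open>x1\<close> lowers the threshold by
    \<open>2 * sqrt n\<close>: one \<open>sqrt n\<close> is the slack in the converse, the other is
    the \<open>t\<close> of the divergence bound.\<close>
  define x1 where "x1 = x0 - 2 / s"
  define c where "c = ?\<Phi> x1 / 2"
  have c: "c > 0" "c < ?\<Phi> x1"
    using std_normal_cdf_pos[of x1] by (auto simp: c_def)

  have "\<forall>\<^sub>F n in sequentially. F n (n * h + x0 * s * sqrt n) < \<delta>"
    by (rule order_tendstoD(2)[OF clt x0])
  moreover have "\<forall>\<^sub>F n in sequentially. c < F n (n * h + x1 * s * sqrt n)"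
    by (rule order_tendstoD(1)[OF clt c(2)])
  moreover have "\<forall>\<^sub>F n in sequentially. exp (- sqrt (real n)) < \<delta>"
    using \<open>\<delta> > 0\<close> by real_asymp
  \<comment> \<open>Half of \<open>c * sqrt n\<close> is set aside to absorb the loss of 1 in
    \<open>code_divergence_ge\<close>; the other half gives the constant
    \<open>c / 2\<close>.\<close>
  moreover have "\<forall>\<^sub>F n in sequentially. 1 \<le> c / 2 * sqrt (real n)"
    using \<open>c > 0\<close> by real_asymp
  ultimately have "\<forall>\<^sub>F n in sequentially. code_divergence P n (M n) (\<phi> n) \<ge> sqrt (real n) * (c / 2)"
    using ev_error eventually_ge_at_top[of 1]
  proof eventually_elim
    case (elim n)
    note code_n = code[OF \<open>1 \<le> n\<close>]
    then have enc: "\<phi> n \<in> words n \<rightarrow> {1..M n}"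
      by (simp add: slepian_wolf_code_def)
    \<comment> \<open>The index of any one word shows that \<open>M n\<close> is nonzero, so
      \<open>exp (ln (M n)) = M n\<close> is available.\<close>
    then have "\<phi> n (replicate n undefined) \<in> {1..M n}"
      by (rule Pi_mem) (simp add: words_def)
    then have "M n > 0"
      by simp
    \<comment> \<open>Otherwise the probability of correct decoding would be below
      \<open>2 * \<delta>\<close>.\<close>
    have "n * h + x0 * s * sqrt n < ln (M n) + sqrt n"
    proof (rule ccontr)
      assume "\<not> ?thesis"
      then have "F n (ln (M n) + sqrt n) < \<delta>"
        using F_mono elim(1) by (meson not_less order.strict_trans1)
      moreover have "M n * exp (- (ln (M n) + sqrt n)) = exp (- sqrt n)"
        using \<open>M n > 0\<close> by (simp add: exp_diff exp_minus exp_add field_simps)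
      then have "1 - error_prob P n (\<phi> n) (\<psi> n) \<le> F n (ln (M n) + sqrt n) + exp (- sqrt n)"
        using prob_correct_le[OF code_n, of P "ln (M n) + sqrt n"] by (simp only: F_def)
      ultimately have "1 - error_prob P n (\<phi> n) (\<psi> n) < \<delta> + \<delta>"
        using elim(3) by linarith
      then show False
        using elim(5) \<open>r < 1\<close> by (simp add: \<delta>_def)
    qed
    moreover have "x1 * s = x0 * s - 2"
      using s by (simp add: x1_def field_simps)
    ultimately have "n * h + x1 * s * sqrt n \<le> ln (M n) - sqrt n"
      by (simp add: left_diff_distrib)
    then have "c \<le> F n (ln (M n) - sqrt n)"
      using F_mono elim(2) by (meson less_imp_le order.trans)
    then have "sqrt n * c - 1 \<le> sqrt n * F n (ln (M n) - sqrt n) - 1"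
      by (simp add: mult_left_mono)
    also have "\<dots> \<le> code_divergence P n (M n) (\<phi> n)"
      unfolding F_def using enc \<open>M n > 0\<close> by (rule code_divergence_ge) simp
    finally show ?case
      using elim(4) by (simp add: mult.commute)
  qed
  then obtain n0 where "\<forall>n\<ge>n0. code_divergence P n (M n) (\<phi> n) \<ge> sqrt (real n) * (c / 2)"
    by (auto simp: eventually_sequentially)
  then show ?thesis
    using \<open>c > 0\<close> by (intro exI[of _ "c / 2"] conjI exI[of _ "max 1 n0"]) auto
qed

end
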